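(* Let $(Q,+)$ be a group, $\alpha,\beta,\gamma,\delta\in Aut(Q,+)$, and $c,d\in Q$. The linear quasigroup $(Q,\cdot)$ given by $x\cdot y=\alpha x+\beta y+c$ and the linear quasigroup $(Q,\circ)$ given by $x\circ y=\gamma y+\delta x+d$ are orthogonal if and only if for every $t\in Q$ the map $(-J_t\gamma^{-1}\delta+\beta^{-1}\alpha)$, i.e. $x\mapsto-J_t\gamma^{-1}\delta x+\beta^{-1}\alpha x$, is a permutation of the set $Q$.
   Context: Groups are written additively but need not be commutative. Products of maps are compositions, $(\alpha\beta)x=\alpha(\beta x)$. A permutation of $Q$ is a bijection $Q\to Q$. For $t\in Q$, $J_t$ is the inner automorphism $J_tx=t+x-t$. Two quasigroups $(Q,\cdot)$ and $(Q,\circ)$ on the same set are orthogonal if for all $a,b\in Q$ the system $x\cdot y=a$, $x\circ y=b$ has a unique solution $(x,y)\in Q\times Q$. *)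

theory Defs
  imports Main
begin

text \<open>The class \<^class>\<open>group_add\<close> does not assume commutativity, so a group \<open>(Q,+)\<close> is
  rendered as a type of this class, and a binary operation on \<open>Q\<close> as a curried function.\<close>

definition group_aut :: "('a::group_add \<Rightarrow> 'a) set" where
  "group_aut = {f. bij f \<and> (\<forall>x y. f (x + y) = f x + f y)}"

definition inner_aut :: "'a::group_add \<Rightarrow> 'a \<Rightarrow> 'a" where
  "inner_aut t x = t + x - t"

definition quasigroup :: "('a \<Rightarrow> 'a \<Rightarrow> 'a) \<Rightarrow> bool" where
  "quasigroup f \<longleftrightarrow> (\<forall>a b. (\<exists>!x. f a x = b) \<and> (\<exists>!y. f y a = b))"

definition orthogonal_quasigroups :: "('a \<Rightarrow> 'a \<Rightarrow> 'a) \<Rightarrow> ('a \<Rightarrow> 'a \<Rightarrow> 'a) \<Rightarrow> bool" where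
  "orthogonal_quasigroups f g \<longleftrightarrow> quasigroup f \<and> quasigroup g \<and>
     (\<forall>a b. \<exists>!p. case p of (x, y) \<Rightarrow> f x y = a \<and> g x y = b)"

end

theory Submission imports Defs begin

text \<open>Put \<open>t = \<beta>\<inverse>(a - c)\<close> and \<open>s = \<gamma>\<inverse>(b - d)\<close>. The first equation of the system says
  \<open>y = -\<beta>\<inverse>\<alpha>x + t\<close>; substituting this, the second becomes
  \<open>-J\<^sub>t\<gamma>\<inverse>\<delta>x + \<beta>\<inverse>\<alpha>x = t - s\<close>. For fixed \<open>t\<close> the right-hand side
  runs over the whole group as \<open>b\<close> varies, so unique solvability for all \<open>a, b\<close> is bijectivity
  for all \<open>t\<close>.\<close>

lemma group_aut_bij: "f \<in> group_aut \<Longrightarrow> bij f"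
  by (simp add: group_aut_def)

lemma group_aut_add: "f \<in> group_aut \<Longrightarrow> f (x + y) = f x + f y"
  by (simp add: group_aut_def)

lemma group_aut_inv: "f \<in> group_aut \<Longrightarrow> inv f \<in> group_aut"
  unfolding group_aut_def
  by (auto simp: bij_imp_bij_inv bij_is_inj bij_is_surj surj_f_inv_f intro!: inv_f_eq)

lemma group_aut_eq_iff: "f \<in> group_aut \<Longrightarrow> f x = y \<longleftrightarrow> x = inv f y"
  using bij_inv_eq_iff[of f x y] group_aut_bij[of f] by auto

lemma add_eq_iff_eq_minus_add: "x + y = z \<longleftrightarrow> y = - x + (z::'a::group_add)"
  by (metis add_minus_cancel minus_add_cancel)

lemma quasigroup_linear:
  assumes "f \<in> group_aut" and "g \<in> group_aut"
  shows "quasigroup (\<lambda>x y. f x + g y + c)"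
proof -
  have 1: "f a + g x + c = b \<longleftrightarrow> x = inv g (- f a + (b - c))" for a b x
    by (metis eq_diff_eq add_eq_iff_eq_minus_add group_aut_eq_iff[OF assms(2)])
  have 2: "f y + g a + c = b \<longleftrightarrow> y = inv f (b - c - g a)" for a b y
    by (simp add: eq_diff_eq[symmetric] group_aut_eq_iff[OF assms(1)])
  have "\<exists>!x. f a + g x + c = b" "\<exists>!y. f y + g a + c = b" for a b
    unfolding 1[of a] 2[of _ a] by simp_all
  then show ?thesis
    by (simp add: quasigroup_def)
qed

text \<open>Needed because the second operation has its \<open>y\<close> summand first: it is the
  opposite of an operation covered by \<open>quasigroup_linear\<close>, and the summands cannot be
  exchanged in a noncommutative group.\<close>

lemma quasigroup_flip: "quasigroup f \<Longrightarrow> quasigroup (\<lambda>x y. f y x)"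
  by (simp add: quasigroup_def)

text \<open>Brings the system into triangular form: the last condition involves \<open>x\<close>
  alone, and \<open>y\<close> is then read off from \<open>x\<close>.\<close>

lemma linear_system_iff:
  fixes a b c d :: "'a::group_add"
  assumes "\<beta> \<in> group_aut" and "\<gamma> \<in> group_aut"
  defines "t \<equiv> inv \<beta> (a - c)" and "s \<equiv> inv \<gamma> (b - d)"
  shows "\<alpha> x + \<beta> y + c = a \<and> \<gamma> y + \<delta> x + d = b \<longleftrightarrow>
    y = - inv \<beta> (\<alpha> x) + t \<and> - inner_aut t (inv \<gamma> (\<delta> x)) + inv \<beta> (\<alpha> x) = t - s"
proof -
  have "\<alpha> x + \<beta> y + c = a \<longleftrightarrow> inv \<beta> (\<alpha> x + \<beta> y) = t"
    unfolding t_def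
    by (simp add: eq_diff_eq[of "\<alpha> x + \<beta> y" a c, symmetric]
        inj_eq[OF bij_is_inj[OF group_aut_bij[OF group_aut_inv[OF assms(1)]]]])
  also have "\<dots> \<longleftrightarrow> y = - inv \<beta> (\<alpha> x) + t"
    by (simp add: group_aut_add[OF group_aut_inv[OF assms(1)]] add_eq_iff_eq_minus_add
        inv_f_f[OF bij_is_inj[OF group_aut_bij[OF assms(1)]]])
  finally have 1: "\<alpha> x + \<beta> y + c = a \<longleftrightarrow> y = - inv \<beta> (\<alpha> x) + t" .
  have "\<gamma> y + \<delta> x + d = b \<longleftrightarrow> inv \<gamma> (\<gamma> y + \<delta> x) = s"
    unfolding s_def
    by (simp add: eq_diff_eq[of "\<gamma> y + \<delta> x" b d, symmetric]
        inj_eq[OF bij_is_inj[OF group_aut_bij[OF group_aut_inv[OF assms(2)]]]])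
  also have "\<dots> \<longleftrightarrow> y + inv \<gamma> (\<delta> x) = s"
    by (simp add: group_aut_add[OF group_aut_inv[OF assms(2)]]
        inv_f_f[OF bij_is_inj[OF group_aut_bij[OF assms(2)]]])
  finally have 2: "\<gamma> y + \<delta> x + d = b \<longleftrightarrow> y + inv \<gamma> (\<delta> x) = s" .
  \<comment> \<open>Both sides equal \<open>t - D - t + B\<close>. With \<open>y = - B + t\<close>
    the right side is \<open>t - (y + D)\<close>; subtraction from \<open>t\<close> is injective, so
    equating it with \<open>t - s\<close> amounts to \<open>y + D = s\<close>.\<close>
  have 3: "- inner_aut t D + B = t - (- B + t + D)" for B D
    by (simp add: inner_aut_def minus_add diff_conv_add_uminus add.assoc del: add_uminus_conv_diff)
  show ?thesis
    unfolding 1 2 3 by (auto simp: diff_conv_add_uminus simp del: add_uminus_conv_diff)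
qed

theorem theorem35:
  fixes \<alpha> \<beta> \<gamma> \<delta> :: "'a::group_add \<Rightarrow> 'a" and c d :: 'a
  assumes "\<alpha> \<in> group_aut" and "\<beta> \<in> group_aut" and "\<gamma> \<in> group_aut" and "\<delta> \<in> group_aut"
  shows "orthogonal_quasigroups (\<lambda>x y. \<alpha> x + \<beta> y + c) (\<lambda>x y. \<gamma> y + \<delta> x + d) \<longleftrightarrow>
    (\<forall>t. bij (\<lambda>x. - inner_aut t (inv \<gamma> (\<delta> x)) + inv \<beta> (\<alpha> x)))"
proof -
  define M where "M t x = - inner_aut t (inv \<gamma> (\<delta> x)) + inv \<beta> (\<alpha> x)" for t x
  \<comment> \<open>Each \<open>x\<close> satisfying the last condition extends to exactly one pair,
    so uniqueness of the pair is uniqueness of \<open>x\<close>.\<close>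
  have sol: "(\<exists>!p. case p of (x, y) \<Rightarrow> \<alpha> x + \<beta> y + c = a \<and> \<gamma> y + \<delta> x + d = b) \<longleftrightarrow>
      (\<exists>!x. M (inv \<beta> (a - c)) x = inv \<beta> (a - c) - inv \<gamma> (b - d))" for a b
    unfolding linear_system_iff[OF assms(2,3)] M_def by auto
  have "orthogonal_quasigroups (\<lambda>x y. \<alpha> x + \<beta> y + c) (\<lambda>x y. \<gamma> y + \<delta> x + d) \<longleftrightarrow>
      (\<forall>a b. \<exists>!x. M (inv \<beta> (a - c)) x = inv \<beta> (a - c) - inv \<gamma> (b - d))"
    unfolding orthogonal_quasigroups_def sol
    using quasigroup_linear[OF assms(1,2)] quasigroup_flip[OF quasigroup_linear[OF assms(3,4)]]
    by blast
  also have "\<dots> \<longleftrightarrow> (\<forall>t u. \<exists>!x. M t x = u)"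
  proof (intro iffI allI)
    fix t u
    assume *: "\<forall>a b. \<exists>!x. M (inv \<beta> (a - c)) x = inv \<beta> (a - c) - inv \<gamma> (b - d)"
    \<comment> \<open>The witnesses \<open>a = \<beta> t + c\<close> and
      \<open>b = \<gamma> (- u + t) + d\<close> turn the right-hand side into
      \<open>t - (- u + t) = u\<close>.\<close>
    have "inv \<beta> (\<beta> t + c - c) = t" "inv \<gamma> (\<gamma> (- u + t) + d - d) = - u + t"
      using assms by (simp_all add: group_aut_bij bij_is_inj)
    then show "\<exists>!x. M t x = u"
      using *[rule_format, of "\<beta> t + c" "\<gamma> (- u + t) + d"]
      by (simp add: minus_add diff_conv_add_uminus add.assoc del: add_uminus_conv_diff)
  qed simp
  also have "\<dots> \<longleftrightarrow> (\<forall>t. bij (M t))"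
    by (simp add: bij_iff)
  finally show ?thesis
    unfolding M_def .
qed

end
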